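(* Let $\mathcal{H}$ be a separable Hilbert space, $K\in B(\mathcal{H})$ an operator with closed range, $I$ a countable index set, $W=\{(W_i,\omega_i)\}_{i\in I}$ a $K$-fusion frame for $\mathcal{H}$, $V=\{(V_i,\upsilon_i)\}_{i\in I}$ a Bessel fusion sequence in $\mathcal{H}$, and $m=\{m_i\}_{i\in I}\in\ell^\infty$. The following assertions hold. 1. If $\mathbf{M}_{m,W,V}=K$, then $V$ satisfies the lower $K^{*}$-fusion frame condition, i.e. there is $A>0$ with $A\|Kf\|^2\le\sum_{i\in I}\upsilon_i^2\|\pi_{V_i}f\|^2$ for all $f\in\mathcal{H}$. In particular, $V$ is a $K^{*}$-fusion frame. 2. If $\mathbf{M}_{m,W,V}$ has a $K$-left inverse, then $V$ is a $K^{*}$-fusion frame.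
   Context: $B(\mathcal{H})$ is the space of bounded linear operators on $\mathcal{H}$, $R(K)$ is the range of $K$, and $\pi_V$ is the orthogonal projection of $\mathcal{H}$ onto a closed subspace $V$. A family $W=\{(W_i,\omega_i)\}_{i\in I}$ of closed subspaces $W_i\subseteq\mathcal{H}$ with weights $\omega_i>0$ is a Bessel fusion sequence if there is $B<\infty$ with $\sum_{i\in I}\omega_i^2\|\pi_{W_i}f\|^2\le B\|f\|^2$ for all $f\in\mathcal{H}$. For $T\in B(\mathcal{H})$, it is a $T$-fusion frame for $\mathcal{H}$ if there are constants $0<A\le B<\infty$ with $A\|T^*f\|^2\le\sum_{i\in I}\omega_i^2\|\pi_{W_i}f\|^2\le B\|f\|^2$ for all $f\in\mathcal{H}$. (So for a $K^*$-fusion frame the lower bound reads $A\|Kf\|^2$.) The frame operator of $W$ is $S_Wf=\sum_{i\in I}\omega_i^2\pi_{W_i}f$. When $W$ is a $K$-fusion frame and $K$ has closed range, $S_W$ restricts to an invertible operator $R(K)\to S_W(R(K))$ with bounded inverse; $S_W^{-1}:S_W(R(K))\to R(K)$ denotes the inverse of this restriction, and $(S_W^{-1})^*:R(K)\to S_W(R(K))$ its adjoint. The $K$-fusion frame multiplier of a $K$-fusion frame $W$, a Bessel fusion sequence $V=\{(V_i,\upsilon_i)\}_{i\in I}$ and $m\in\ell^\infty$ is the bounded operator $$\mathbf{M}_{m,W,V}f=\sum_{i\in I}m_i\omega_i\upsilon_i\,\pi_{W_i}(S_W^{-1})^{*}K\pi_{V_i}f,\qquad f\in\mathcal{H}.$$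 A $K$-left inverse of $\mathbf{M}_{m,W,V}$ is an operator $\mathcal{L}:\mathcal{H}\to\mathcal{H}$ with $\mathcal{L}\,\mathbf{M}_{m,W,V}=K$. *)

theory Defs
  imports "HOL-Analysis.Analysis"
begin

text \<open>
  The scalar field of a Hilbert space is the real or the complex field.  To cover both cases at
  once, scalars range over a class of real normed fields carrying a conjugation \<open>conj\<close> with
  \<open>z * conj z = \<bar>z\<bar>\<^sup>2\<close>.  By the Gelfand--Mazur theorem, the only fields of this class are,
  up to isomorphism, the reals (with the identity) and the complex numbers (with \<open>cnj\<close>).
\<close>

class real_or_complex = real_normed_field +
  fixes conj :: "'a \<Rightarrow> 'a"
  assumes conj_add: "conj (x + y) = conj x + conj y"
    and conj_mult: "conj (x * y) = conj x * conj y"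
    and conj_conj: "conj (conj x) = x"
    and conj_scaleR_one: "conj (r *\<^sub>R 1) = r *\<^sub>R 1"
    and mult_conj: "x * conj x = (norm x)\<^sup>2 *\<^sub>R 1"

instantiation real :: real_or_complex
begin
definition conj_real :: "real \<Rightarrow> real" where "conj_real x = x"
instance by standard (auto simp: conj_real_def power2_eq_square)
end

instantiation complex :: real_or_complex
begin
definition conj_complex :: "complex \<Rightarrow> complex" where "conj_complex z = cnj z"
instance by standard (auto simp: conj_complex_def complex_norm_square[symmetric] scaleR_conv_of_real)
end

text \<open>
  A Hilbert space over \<open>'k\<close>: completeness is part of the class \<open>banach\<close>, whose norm is required
  to be the one induced by the inner product \<open>ip\<close>, and whose real scalar multiplication is
  required to be the restriction of \<open>smul\<close>.  The inner product is linear in its first argument.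
\<close>

locale hilbert_space = vector_space smul
  for smul :: "'k::real_or_complex \<Rightarrow> 'h::banach \<Rightarrow> 'h" +
  fixes ip :: "'h \<Rightarrow> 'h \<Rightarrow> 'k"
  assumes scale_of_real: "smul (of_real r) x = r *\<^sub>R x"
    and ip_add_left: "ip (x + y) z = ip x z + ip y z"
    and ip_scale_left: "ip (smul c x) y = c * ip x y"
    and ip_conj: "ip y x = conj (ip x y)"
    and ip_self: "ip x x = of_real ((norm x)\<^sup>2)"

lemma hilbert_space_real_inner:
  "hilbert_space scaleR (inner :: 'h::{real_inner, banach} \<Rightarrow> 'h \<Rightarrow> real)"
  by unfold_locales
    (auto simp: algebra_simps conj_real_def inner_commute power2_norm_eq_inner inner_add_left)

lemma hilbert_space_complex: "hilbert_space (*) (\<lambda>z w :: complex. z * cnj w)"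
  by unfold_locales
    (auto simp: algebra_simps conj_complex_def scaleR_conv_of_real complex_norm_square[symmetric])

definition bounded_operator :: "('k::field \<Rightarrow> 'h::real_normed_vector \<Rightarrow> 'h) \<Rightarrow> ('h \<Rightarrow> 'h) \<Rightarrow> bool"
  where "bounded_operator smul T \<longleftrightarrow> Vector_Spaces.linear smul smul T \<and> bounded_linear T"

definition orth_proj :: "('h \<Rightarrow> 'h \<Rightarrow> 'k::zero) \<Rightarrow> 'h set \<Rightarrow> 'h::ab_group_add \<Rightarrow> 'h"
  where "orth_proj ip V f = (THE p. p \<in> V \<and> (\<forall>v\<in>V. ip (f - p) v = 0))"

text \<open>
  For a bounded operator \<open>T : X \<rightarrow> Y\<close> between closed subspaces \<open>X\<close> and \<open>Y\<close>, the function
  \<open>adjoint_from ip X T\<close> is, on \<open>Y\<close>, the Hilbert space adjoint \<open>T\<^sup>* : Y \<rightarrow> X\<close>.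
\<close>

definition adjoint_from :: "('h \<Rightarrow> 'h \<Rightarrow> 'k) \<Rightarrow> 'h set \<Rightarrow> ('h \<Rightarrow> 'h) \<Rightarrow> 'h \<Rightarrow> 'h"
  where "adjoint_from ip X T y = (THE z. z \<in> X \<and> (\<forall>x\<in>X. ip (T x) y = ip x z))"

abbreviation hilbert_adjoint :: "('h \<Rightarrow> 'h \<Rightarrow> 'k) \<Rightarrow> ('h \<Rightarrow> 'h) \<Rightarrow> 'h \<Rightarrow> 'h"
  where "hilbert_adjoint ip T \<equiv> adjoint_from ip UNIV T"

definition weighted_subspaces ::
  "('k::real_or_complex \<Rightarrow> 'h::banach \<Rightarrow> 'h) \<Rightarrow> 'i set \<Rightarrow> ('i \<Rightarrow> 'h set) \<Rightarrow> ('i \<Rightarrow> real) \<Rightarrow> bool"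
  where "weighted_subspaces smul I W \<omega> \<longleftrightarrow>
    (\<forall>i\<in>I. module.subspace smul (W i) \<and> closed (W i) \<and> \<omega> i > 0)"

text \<open>
  Since \<open>infsum\<close> is \<open>0\<close> on a divergent series, the finiteness of the sum that is implicit in an
  upper bound is stated separately below.
\<close>

definition bessel_fusion_sequence ::
  "('k::real_or_complex \<Rightarrow> 'h::banach \<Rightarrow> 'h) \<Rightarrow> ('h \<Rightarrow> 'h \<Rightarrow> 'k) \<Rightarrow>
    'i set \<Rightarrow> ('i \<Rightarrow> 'h set) \<Rightarrow> ('i \<Rightarrow> real) \<Rightarrow> bool"
  where "bessel_fusion_sequence smul ip I W \<omega> \<longleftrightarrow> weighted_subspaces smul I W \<omega> \<and>
    (\<exists>B. \<forall>f. (\<lambda>i. (\<omega> i)\<^sup>2 * (norm (orth_proj ip (W i) f))\<^sup>2) summable_on I \<and>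
      (\<Sum>\<^sub>\<infinity>i\<in>I. (\<omega> i)\<^sup>2 * (norm (orth_proj ip (W i) f))\<^sup>2) \<le> B * (norm f)\<^sup>2)"

definition fusion_frame_for ::
  "('k::real_or_complex \<Rightarrow> 'h::banach \<Rightarrow> 'h) \<Rightarrow> ('h \<Rightarrow> 'h \<Rightarrow> 'k) \<Rightarrow> ('h \<Rightarrow> 'h) \<Rightarrow>
    'i set \<Rightarrow> ('i \<Rightarrow> 'h set) \<Rightarrow> ('i \<Rightarrow> real) \<Rightarrow> bool"
  where "fusion_frame_for smul ip T I W \<omega> \<longleftrightarrow> weighted_subspaces smul I W \<omega> \<and>
    (\<exists>A B. 0 < A \<and> A \<le> B \<and> (\<forall>f.
      (\<lambda>i. (\<omega> i)\<^sup>2 * (norm (orth_proj ip (W i) f))\<^sup>2) summable_on I \<and>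
      A * (norm (hilbert_adjoint ip T f))\<^sup>2
        \<le> (\<Sum>\<^sub>\<infinity>i\<in>I. (\<omega> i)\<^sup>2 * (norm (orth_proj ip (W i) f))\<^sup>2) \<and>
      (\<Sum>\<^sub>\<infinity>i\<in>I. (\<omega> i)\<^sup>2 * (norm (orth_proj ip (W i) f))\<^sup>2) \<le> B * (norm f)\<^sup>2))"

definition frame_operator ::
  "('h::banach \<Rightarrow> 'h \<Rightarrow> 'k::zero) \<Rightarrow> 'i set \<Rightarrow> ('i \<Rightarrow> 'h set) \<Rightarrow> ('i \<Rightarrow> real) \<Rightarrow> 'h \<Rightarrow> 'h"
  where "frame_operator ip I W \<omega> f = (\<Sum>\<^sub>\<infinity>i\<in>I. (\<omega> i)\<^sup>2 *\<^sub>R orth_proj ip (W i) f)"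

text \<open>The inverse \<open>S\<^sub>W(R(K)) \<rightarrow> R(K)\<close> of the restriction of the frame operator to \<open>R(K)\<close>.\<close>

definition frame_operator_inverse ::
  "('h::banach \<Rightarrow> 'h \<Rightarrow> 'k::zero) \<Rightarrow> ('h \<Rightarrow> 'h) \<Rightarrow>
    'i set \<Rightarrow> ('i \<Rightarrow> 'h set) \<Rightarrow> ('i \<Rightarrow> real) \<Rightarrow> 'h \<Rightarrow> 'h"
  where "frame_operator_inverse ip K I W \<omega> = inv_into (range K) (frame_operator ip I W \<omega>)"

text \<open>Its adjoint \<open>R(K) \<rightarrow> S\<^sub>W(R(K))\<close>.\<close>

definition frame_operator_inverse_adjoint ::
  "('h::banach \<Rightarrow> 'h \<Rightarrow> 'k::zero) \<Rightarrow> ('h \<Rightarrow> 'h) \<Rightarrow>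
    'i set \<Rightarrow> ('i \<Rightarrow> 'h set) \<Rightarrow> ('i \<Rightarrow> real) \<Rightarrow> 'h \<Rightarrow> 'h"
  where "frame_operator_inverse_adjoint ip K I W \<omega> =
    adjoint_from ip (frame_operator ip I W \<omega> ` range K) (frame_operator_inverse ip K I W \<omega>)"

definition fusion_multiplier ::
  "('k::real_or_complex \<Rightarrow> 'h::banach \<Rightarrow> 'h) \<Rightarrow> ('h \<Rightarrow> 'h \<Rightarrow> 'k) \<Rightarrow> ('h \<Rightarrow> 'h) \<Rightarrow> 'i set \<Rightarrow>
    ('i \<Rightarrow> 'k) \<Rightarrow> ('i \<Rightarrow> 'h set) \<Rightarrow> ('i \<Rightarrow> real) \<Rightarrow> ('i \<Rightarrow> 'h set) \<Rightarrow> ('i \<Rightarrow> real) \<Rightarrow> 'h \<Rightarrow> 'h"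
  where "fusion_multiplier smul ip K I m W \<omega> V \<upsilon> f =
    (\<Sum>\<^sub>\<infinity>i\<in>I. smul (m i * of_real (\<omega> i) * of_real (\<upsilon> i))
      (orth_proj ip (W i)
        (frame_operator_inverse_adjoint ip K I W \<omega> (K (orth_proj ip (V i) f)))))"

text \<open>Operators on the Hilbert space are bounded, so a left inverse is a bounded operator.\<close>

definition has_K_left_inverse ::
  "('k::field \<Rightarrow> 'h::real_normed_vector \<Rightarrow> 'h) \<Rightarrow> ('h \<Rightarrow> 'h) \<Rightarrow> ('h \<Rightarrow> 'h) \<Rightarrow> bool"
  where "has_K_left_inverse smul K M \<longleftrightarrow> (\<exists>L. bounded_operator smul L \<and> L \<circ> M = K)"

end

theory Submission
  imports Defs
begin

text \<open>
  Testing against an arbitrary vector and using Cauchy--Schwarz together with the Bessel bound of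
  \<open>W\<close>, one gets \<open>\<parallel>M f\<parallel>\<^sup>2 \<le> D \<cdot> (\<Sum>i. \<upsilon>\<^sub>i\<^sup>2 \<parallel>\<pi>\<^bsub>V\<^sub>i\<^esub> f\<parallel>\<^sup>2)\<close> as soon as \<open>(S\<^sub>W\<^sup>-\<^sup>1)\<^sup>*\<close> is
  bounded on \<open>R(K)\<close>; then \<open>L M = K\<close> yields the lower bound for \<open>V\<close>, and the case \<open>M = K\<close> is \<open>L = id\<close>.
  Indeed \<open>\<parallel>f\<parallel> \<le> C \<parallel>K\<^sup>* f\<parallel>\<close> holds on the closed range of \<open>K\<close>, so the
  lower frame bound \<open>A \<parallel>K\<^sup>* f\<parallel>\<^sup>2 \<le> \<langle>S\<^sub>W f, f\<rangle> \<le> \<parallel>S\<^sub>W f\<parallel> \<parallel>f\<parallel>\<close> makes \<open>S\<^sub>W\<close> bounded below there.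
\<close>

section \<open>Conjugation on the scalars\<close>

lemma conj_zero [simp]: "conj (0 :: 'k::real_or_complex) = 0"
  using conj_add[of "0 :: 'k" 0] by simp

lemma conj_of_real [simp]: "conj (of_real r :: 'k::real_or_complex) = of_real r"
  by (simp add: of_real_def conj_scaleR_one)

lemma mult_conj_of_real: "x * conj x = of_real ((norm x)\<^sup>2)" for x :: "'k::real_or_complex"
  by (simp add: of_real_def mult_conj)

section \<open>Uniform boundedness and unconditional summability in Banach spaces\<close>

lemma uniform_boundedness_on_closed_subspace:
  fixes X :: "'a::banach set" and F :: "('a \<Rightarrow> 'b::real_normed_vector) set"
  assumes X: "subspace X" "closed X"
    and lin: "\<And>f. f \<in> F \<Longrightarrow> bounded_linear f"
    and bdd: "\<And>x. x \<in> X \<Longrightarrow> bounded ((\<lambda>f. f x) ` F)"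
  shows "\<exists>C\<ge>0. \<forall>f\<in>F. \<forall>x\<in>X. norm (f x) \<le> C * norm x"
proof -
  \<comment> \<open>These sets are closed, and pointwise boundedness makes them cover
    \<open>X\<close>. By Baire, one of them contains a ball of \<open>X\<close>.\<close>
  define A where "A n = X \<inter> (\<Inter>f\<in>F. {x. norm (f x) \<le> real n})" for n
  have cl: "closedin (top_of_set X) (A n)" for n
  proof (rule closed_subset)
    show "closed (A n)"
      unfolding A_def
      by (intro closed_Int X closed_INT ballI closed_Collect_le continuous_on_const
          continuous_on_norm linear_continuous_on lin)
  qed (simp add: A_def)
  have "X \<subseteq> \<Union>(range A)"
  proof
    fix x assume x: "x \<in> X"
    obtain r where "\<forall>y\<in>(\<lambda>f. f x) ` F. norm y \<le> r"
      using bdd[OF x] unfolding bounded_iff by blast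
    moreover obtain n where "r \<le> real n" using real_arch_simple by blast
    ultimately have "x \<in> A n" using x by (force simp: A_def)
    then show "x \<in> \<Union>(range A)" by blast
  qed
  then have UA: "\<Union>(range A) = X" by (auto simp: A_def)
  \<comment> \<open>As a closed set, \<open>X\<close> is completely metrizable. If every
    \<open>A n\<close> had empty interior relative to \<open>X\<close>, then so would their union
    \<open>X\<close>, which is impossible because it contains 0.\<close>
  have "\<exists>n. top_of_set X interior_of A n \<noteq> {}"
  proof (rule ccontr)
    assume "\<nexists>n. top_of_set X interior_of A n \<noteq> {}"
    then have "top_of_set X interior_of \<Union>(range A) = {}"
      by (intro Baire_category_alt disjI1 completely_metrizable_space_closedin
          completely_metrizable_space_euclidean countable_image)
        (use cl X in auto)
    then show False using UA subspace_0[OF X(1)] interior_of_topspace[of "top_of_set X"] by auto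
  qed
  then obtain n U x0 where U: "openin (top_of_set X) U" "x0 \<in> U" "U \<subseteq> A n"
    unfolding interior_of_def by blast
  then obtain e where e: "e > 0" "ball x0 e \<inter> X \<subseteq> A n"
    by (meson openin_contains_ball order_trans)
  have x0: "x0 \<in> X" "x0 \<in> A n" using U by (auto simp: A_def)
  \<comment> \<open>A step of length \<open>e / 2\<close> in direction \<open>x\<close> stays in the
    ball around \<open>x0\<close>. Both values of \<open>f\<close> then have norm at most
    \<open>n\<close>, so their difference, \<open>t\<close> times \<open>f x\<close>, has norm at
    most \<open>2 * n\<close>. Dividing by \<open>t\<close> gives the constant.\<close>
  have "norm (f x) \<le> (4 * real n / e) * norm x" if f: "f \<in> F" and x: "x \<in> X" for f x
  proof (cases "x = 0")
    case True
    then show ?thesis using linear_0[OF bounded_linear.linear[OF lin[OF f]]] by simp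
  next
    case False
    define t where "t = e / (2 * norm x)"
    have t: "t > 0" "norm (t *\<^sub>R x) < e" using e False by (auto simp: t_def)
    have "x0 + t *\<^sub>R x \<in> ball x0 e \<inter> X"
      using t x0 x X by (auto simp: dist_norm intro: subspace_add subspace_scale)
    then have "x0 + t *\<^sub>R x \<in> A n" using e by blast
    then have "norm (f (x0 + t *\<^sub>R x)) \<le> real n" "norm (f x0) \<le> real n"
      using x0 f by (auto simp: A_def)
    then have "norm (f (x0 + t *\<^sub>R x) - f x0) \<le> 2 * real n"
      using norm_triangle_ineq4[of "f (x0 + t *\<^sub>R x)" "f x0"] by linarith
    also have "f (x0 + t *\<^sub>R x) - f x0 = t *\<^sub>R f x"
      using bounded_linear.linear[OF lin[OF f]] by (simp add: linear_add linear_scale)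
    finally have "t * norm (f x) \<le> 2 * real n" using t by simp
    then show ?thesis using e False by (simp add: t_def field_simps)
  qed
  then show ?thesis using e by (intro exI[of _ "4 * real n / e"]) auto
qed

text \<open>Small tails of \<open>g\<close> force small tails of \<open>f\<close>, so the net of
  finite partial sums is Cauchy. Absolute summability of \<open>f\<close> is not assumed: for the
  frame operator only the squared norm of a block of terms is controlled.\<close>

lemma summable_on_if_norm_sum_sq_le:
  fixes f :: "'i \<Rightarrow> 'a::banach" and g :: "'i \<Rightarrow> real"
  assumes g: "g summable_on I" "\<And>i. i \<in> I \<Longrightarrow> 0 \<le> g i"
    and le: "\<And>F. finite F \<Longrightarrow> F \<subseteq> I \<Longrightarrow> (norm (sum f F))\<^sup>2 \<le> C * sum g F"
    and C: "0 \<le> C"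
  shows "f summable_on I"
proof -
  have "\<exists>P. eventually P (finite_subsets_at_top I) \<and>
      (\<forall>F1 F2. P F1 \<and> P F2 \<longrightarrow> dist (sum f F1) (sum f F2) < e)" if "e > 0" for e
  proof -
    \<comment> \<open>The summand 1 in the denominator makes \<open>C * d\<close> strictly smaller
      than the squared half tolerance and also covers \<open>C = 0\<close>.\<close>
    define d where "d = (e / 2)\<^sup>2 / (C + 1)"
    have d: "d > 0" "C * d < (e / 2)\<^sup>2"
      using that C by (auto simp: d_def field_simps)
    obtain F0 where F0: "finite F0" "F0 \<subseteq> I" "dist (sum g F0) (infsum g I) \<le> d"
      using infsum_finite_approximation[OF g(1) d(1)] by blast
    have near: "dist (sum f F) (sum f F0) < e / 2" if F: "finite F" "F0 \<subseteq> F" "F \<subseteq> I" for F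
    proof -
      have "sum g F \<le> infsum g I" by (rule finite_sum_le_infsum) (use g F in auto)
      then have "sum g (F - F0) \<le> d"
        using F0 F by (simp add: sum_diff dist_real_def)
      then have "(norm (sum f (F - F0)))\<^sup>2 \<le> C * d"
        using le[of "F - F0"] F C by (meson Diff_subset finite_Diff mult_left_mono order_trans)
      then have "(norm (sum f (F - F0)))\<^sup>2 < (e / 2)\<^sup>2" using d by linarith
      then show ?thesis
        using that F0 F \<open>e > 0\<close> power_less_imp_less_base[of _ 2 "e / 2"]
        by (simp add: sum_diff dist_norm)
    qed
    have "dist (sum f F1) (sum f F2) < e"
      if "finite F1" "F0 \<subseteq> F1" "F1 \<subseteq> I" "finite F2" "F0 \<subseteq> F2" "F2 \<subseteq> I" for F1 F2
      using near[OF that(1-3)] near[OF that(4-6)] by (rule dist_triangle_half_l)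
    moreover have "eventually (\<lambda>F. finite F \<and> F0 \<subseteq> F \<and> F \<subseteq> I) (finite_subsets_at_top I)"
      using F0 by (auto simp: eventually_finite_subsets_at_top)
    ultimately show ?thesis
      by (intro exI[of _ "\<lambda>F. finite F \<and> F0 \<subseteq> F \<and> F \<subseteq> I"]) simp
  qed
  then have "cauchy_filter (filtermap (sum f) (finite_subsets_at_top I))"
    by (simp add: cauchy_filter_metric_filtermap)
  moreover have "complete (UNIV :: 'a set)" by (rule complete_UNIV)
  ultimately obtain L where "(sum f \<longlongrightarrow> L) (finite_subsets_at_top I)"
    using complete_uniform[where S = UNIV] by (force simp: filterlim_def)
  then show ?thesis using summable_on_def has_sum_def by blast
qed

section \<open>Inner product and norm\<close>

context hilbert_space
begin

lemma ip_zero_left [simp]: "ip 0 y = 0"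
  using ip_add_left[of 0 0 y] by simp

lemma ip_minus_left: "ip (- x) y = - ip x y"
  using ip_add_left[of x "- x" y] by (simp add: eq_neg_iff_add_eq_0 add.commute)

lemma ip_diff_left: "ip (x - y) z = ip x z - ip y z"
  using ip_add_left[of x "- y" z] by (simp add: ip_minus_left)

lemma ip_add_right: "ip x (y + z) = ip x y + ip x z"
  by (metis ip_conj ip_add_left conj_add)

lemma ip_zero_right [simp]: "ip x 0 = 0"
  using ip_add_right[of x 0 0] by simp

lemma ip_diff_right: "ip x (y - z) = ip x y - ip x z"
  by (metis add_diff_cancel diff_add_cancel ip_add_right)

lemma ip_scale_right: "ip x (smul c y) = conj c * ip x y"
  by (metis ip_conj ip_scale_left conj_mult)

lemma ip_scaleR_left: "ip (r *\<^sub>R x) y = of_real r * ip x y"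
  by (metis scale_of_real ip_scale_left)

lemma ip_sum_left: "ip (sum f F) y = (\<Sum>i\<in>F. ip (f i) y)"
  by (induction F rule: infinite_finite_induct) (auto simp: ip_add_left)

lemma ip_self_eq_0_iff [simp]: "ip x x = 0 \<longleftrightarrow> x = 0"
  by (simp add: ip_self)

lemma norm_smul: "norm (smul c x) = norm c * norm x"
proof -
  have "of_real ((norm (smul c x))\<^sup>2) = (c * conj c) * ip x x"
    by (simp only: ip_self[symmetric] ip_scale_left ip_scale_right ac_simps)
  also have "\<dots> = of_real ((norm c * norm x)\<^sup>2)"
    by (simp add: mult_conj_of_real ip_self power_mult_distrib)
  finally have "(norm (smul c x))\<^sup>2 = (norm c * norm x)\<^sup>2"
    by (simp only: of_real_eq_iff)
  then show ?thesis by simp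
qed

lemma smul_scaleR: "smul c (r *\<^sub>R x) = r *\<^sub>R smul c x"
  by (metis scale_of_real scale_left_commute)

lemma subspace_scaleR: "subspace X \<Longrightarrow> x \<in> X \<Longrightarrow> r *\<^sub>R x \<in> X"
  by (metis scale_of_real subspace_scale)

text \<open>Transfers subspaces over the scalar field to the Banach space results above and in the
  library, which are stated for real subspaces.\<close>

lemma real_subspace: "subspace X \<Longrightarrow> real_vector.subspace X"
  by (auto intro!: real_vector.subspaceI subspace_scaleR simp: subspace_0 subspace_add)

lemma parallelogram:
  fixes x y :: 'h
  shows "(norm (x + y))\<^sup>2 + (norm (x - y))\<^sup>2 = 2 * (norm x)\<^sup>2 + 2 * (norm y)\<^sup>2"
proof -
  have "ip (x + y) (x + y) + ip (x - y) (x - y) = 2 * ip x x + 2 * ip y y"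
    by (simp add: ip_add_left ip_add_right ip_diff_left ip_diff_right)
  then have "(of_real ((norm (x + y))\<^sup>2 + (norm (x - y))\<^sup>2) :: 'k)
      = of_real (2 * (norm x)\<^sup>2 + 2 * (norm y)\<^sup>2)"
    by (simp add: ip_self)
  then show ?thesis by (simp only: of_real_eq_iff)
qed

text \<open>This computation serves twice: nonnegativity of the left side is Cauchy-Schwarz, and the
  strict drop for a nonzero inner product shows that a nearest point is an orthogonal
  projection.\<close>

lemma norm_remove_component:
  assumes "v \<noteq> 0"
  shows "(norm (w - smul (of_real (1 / (norm v)\<^sup>2) * ip w v) v))\<^sup>2
    = (norm w)\<^sup>2 - (norm (ip w v))\<^sup>2 / (norm v)\<^sup>2"
proof -
  define a where "a = ip w v"
  define N where "N = (norm v)\<^sup>2"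
  define r :: 'k where "r = of_real (1 / N)"
  define u where "u = w - smul (r * a) v"
  have "N \<noteq> 0" using assms by (simp add: N_def)
  then have r: "r * of_real N = 1" "conj r = r"
    by (simp_all add: r_def del: of_real_divide flip: of_real_mult)
  have vw: "ip v w = conj a" by (simp add: a_def ip_conj[of v w])
  have "ip u u = ip w w - r * (a * conj a) - r * (a * conj a) + r * (r * of_real N) * (a * conj a)"
    unfolding u_def
    by (simp add: ip_diff_left ip_diff_right ip_scale_left ip_scale_right conj_mult vw r(2)
        ip_self[of v] N_def[symmetric] a_def[symmetric] algebra_simps)
  then have "ip u u = ip w w - r * (a * conj a)" by (simp add: r)
  then have "(of_real ((norm u)\<^sup>2) :: 'k) = of_real ((norm w)\<^sup>2 - (norm a)\<^sup>2 / N)"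
    by (simp add: ip_self mult_conj_of_real r_def)
  then show ?thesis by (simp only: of_real_eq_iff r_def u_def a_def N_def)
qed

lemma Cauchy_Schwarz: "norm (ip x y) \<le> norm x * norm y"
proof (cases "y = 0")
  case False
  have "(norm (ip x y))\<^sup>2 / (norm y)\<^sup>2 \<le> (norm x)\<^sup>2"
    using norm_remove_component[OF False, of x]
      zero_le_power2[of "norm (x - smul (of_real (1 / (norm y)\<^sup>2) * ip x y) y)"] by linarith
  then have "(norm (ip x y))\<^sup>2 \<le> (norm x * norm y)\<^sup>2"
    using False by (simp add: pos_divide_le_eq power_mult_distrib)
  then show ?thesis by (rule power2_le_imp_le) simp
qed simp

lemma bounded_linear_ip_left: "bounded_linear (\<lambda>x. ip x y)"
  by (rule bounded_linear_intro[where K = "norm y"])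
    (auto simp: ip_add_left ip_scaleR_left scaleR_conv_of_real Cauchy_Schwarz)

section \<open>Orthogonal projections onto closed subspaces\<close>

lemma exists_projection:
  assumes X: "subspace X" and cl: "closed X"
  shows "\<exists>p\<in>X. \<forall>v\<in>X. ip (f - p) v = 0"
proof -
  define S where "S = (\<lambda>v. (norm (f - v))\<^sup>2) ` X"
  define d where "d = Inf S"
  have ne: "S \<noteq> {}" using subspace_0[OF X] by (auto simp: S_def)
  have bdd: "bdd_below S" by (rule bdd_belowI[of _ 0]) (auto simp: S_def)
  have le: "d \<le> (norm (f - v))\<^sup>2" if "v \<in> X" for v
    unfolding d_def by (rule cInf_lower[OF _ bdd]) (use that in \<open>simp add: S_def\<close>)
  have "\<exists>v\<in>X. (norm (f - v))\<^sup>2 < d + 1 / real (Suc n)" for n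
    using cInf_lessD[OF ne, of "d + 1 / real (Suc n)"] by (auto simp: S_def d_def)
  then obtain y where y: "\<And>n. y n \<in> X" "\<And>n. (norm (f - y n))\<^sup>2 < d + 1 / real (Suc n)"
    by metis
  \<comment> \<open>The midpoint of \<open>y i\<close> and \<open>y j\<close> lies in
    \<open>X\<close>, so its squared distance to \<open>f\<close> is at least \<open>d\<close>. The
    parallelogram law then leaves only the two errors of the minimizing sequence.\<close>
  have diff: "(norm (y i - y j))\<^sup>2 \<le> 2 * (1 / real (Suc i)) + 2 * (1 / real (Suc j))" for i j
  proof -
    have "(1/2) *\<^sub>R (y i + y j) \<in> X"
      by (intro subspace_scaleR subspace_add X y)
    then have "d \<le> (norm (f - (1/2) *\<^sub>R (y i + y j)))\<^sup>2" by (rule le)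
    moreover have "(f - y i) + (f - y j) = 2 *\<^sub>R (f - (1/2) *\<^sub>R (y i + y j))"
      by (simp add: algebra_simps scaleR_2)
    then have "(norm ((f - y i) + (f - y j)))\<^sup>2 = 4 * (norm (f - (1/2) *\<^sub>R (y i + y j)))\<^sup>2"
      by (simp only: norm_scaleR power_mult_distrib) simp
    moreover have "norm ((f - y i) - (f - y j)) = norm (y i - y j)"
      by (simp add: norm_minus_commute)
    ultimately show ?thesis
      using parallelogram[of "f - y i" "f - y j"] y(2)[of i] y(2)[of j] by simp
  qed
  have "Cauchy y"
  proof (rule metric_CauchyI)
    fix e :: real assume "e > 0"
    then have "e\<^sup>2 / 4 > 0" by simp
    then obtain N where N: "1 / real (Suc N) < e\<^sup>2 / 4"
      using nat_approx_posE by blast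
    have "dist (y i) (y j) < e" if "i \<ge> N" "j \<ge> N" for i j
    proof -
      have "1 / real (Suc i) \<le> 1 / real (Suc N)" "1 / real (Suc j) \<le> 1 / real (Suc N)"
        using that by (auto intro!: divide_left_mono)
      then have "(norm (y i - y j))\<^sup>2 < e\<^sup>2"
        using diff[of i j] N by linarith
      then show ?thesis
        using \<open>e > 0\<close> by (simp add: dist_norm power_less_imp_less_base)
    qed
    then show "\<exists>N. \<forall>i\<ge>N. \<forall>j\<ge>N. dist (y i) (y j) < e" by blast
  qed
  then obtain p where p: "y \<longlonglongrightarrow> p" using Cauchy_convergent convergent_def by blast
  have pX: "p \<in> X" using closed_sequentially[OF cl y(1) p] .
  have "(\<lambda>n. (norm (f - y n))\<^sup>2) \<longlonglongrightarrow> (norm (f - p))\<^sup>2"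
    by (intro tendsto_intros p)
  moreover have "(\<lambda>n. d + 1 / real (Suc n)) \<longlonglongrightarrow> d + 0"
    by (intro tendsto_intros LIMSEQ_Suc lim_1_over_n)
  ultimately have "(norm (f - p))\<^sup>2 \<le> d + 0"
    by (rule LIMSEQ_le) (use y(2) less_imp_le in blast)
  then have min: "(norm (f - p))\<^sup>2 \<le> d" by simp
  \<comment> \<open>Moving \<open>p\<close> by the component of \<open>f - p\<close> along
    \<open>v\<close> stays in \<open>X\<close> and lowers the squared distance by
    \<open>(norm (ip (f - p) v))\<^sup>2 / (norm v)\<^sup>2\<close>. Minimality forces this amount
    to be 0.\<close>
  have "ip (f - p) v = 0" if v: "v \<in> X" for v
  proof (cases "v = 0")
    case False
    let ?c = "of_real (1 / (norm v)\<^sup>2) * ip (f - p) v"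
    have "p + smul ?c v \<in> X" by (intro subspace_add subspace_scale X pX v)
    from order_trans[OF min le[OF this]]
    have "(norm (f - p))\<^sup>2 \<le> (norm (f - p - smul ?c v))\<^sup>2"
      by (simp only: diff_diff_add)
    then have "(norm (ip (f - p) v))\<^sup>2 / (norm v)\<^sup>2 \<le> 0"
      unfolding norm_remove_component[OF False] by simp
    then show ?thesis using False by (simp add: divide_le_0_iff)
  qed simp
  with pX show ?thesis by blast
qed

lemma orth_proj_unique:
  assumes X: "subspace X" and "p \<in> X" "\<And>v. v \<in> X \<Longrightarrow> ip (f - p) v = 0"
    and "q \<in> X" "\<And>v. v \<in> X \<Longrightarrow> ip (f - q) v = 0"
  shows "p = q"
proof -
  have pq: "p - q \<in> X" using assms by (simp add: subspace_diff)
  have "ip (p - q) (p - q) = ip (f - q) (p - q) - ip (f - p) (p - q)"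
    by (simp add: ip_diff_left)
  then show ?thesis using assms pq by simp
qed

lemma orth_proj_eqI:
  assumes "subspace X" "p \<in> X" "\<And>v. v \<in> X \<Longrightarrow> ip (f - p) v = 0"
  shows "orth_proj ip X f = p"
  unfolding orth_proj_def using assms orth_proj_unique[of X]
  by (intro the_equality) blast+

context
  fixes X :: "'h set"
  assumes X: "subspace X" and cl: "closed X"
begin

lemma orth_proj_in: "orth_proj ip X f \<in> X"
  and ip_orth_proj: "v \<in> X \<Longrightarrow> ip (f - orth_proj ip X f) v = 0"
proof -
  obtain p where p: "p \<in> X" "\<And>v. v \<in> X \<Longrightarrow> ip (f - p) v = 0"
    using exists_projection[OF X cl, of f] by blast
  have "orth_proj ip X f = p" by (rule orth_proj_eqI[OF X p])
  then show "orth_proj ip X f \<in> X" "v \<in> X \<Longrightarrow> ip (f - orth_proj ip X f) v = 0"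
    using p by simp_all
qed

lemma ip_orth_proj_mem: "v \<in> X \<Longrightarrow> ip (orth_proj ip X f) v = ip f v"
  using ip_orth_proj[of v f] by (simp add: ip_diff_left)

lemma ip_orth_proj_commute: "ip (orth_proj ip X f) g = ip f (orth_proj ip X g)"
  by (metis ip_orth_proj_mem orth_proj_in ip_conj)

lemma orth_proj_idem: "orth_proj ip X (orth_proj ip X f) = orth_proj ip X f"
  by (rule orth_proj_eqI[OF X]) (auto simp: orth_proj_in)

lemma ip_orth_proj_self: "ip (orth_proj ip X f) f = of_real ((norm (orth_proj ip X f))\<^sup>2)"
  by (metis ip_orth_proj_commute orth_proj_idem ip_self)

lemma orth_proj_add: "orth_proj ip X (f + g) = orth_proj ip X f + orth_proj ip X g"
  by (rule orth_proj_eqI[OF X])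
    (auto simp: orth_proj_in subspace_add[OF X] ip_diff_left ip_add_left ip_orth_proj_mem)

lemma orth_proj_smul: "orth_proj ip X (smul c f) = smul c (orth_proj ip X f)"
  by (rule orth_proj_eqI[OF X])
    (auto simp: orth_proj_in subspace_scale[OF X] ip_diff_left ip_scale_left ip_orth_proj_mem)

lemma orth_proj_scaleR: "orth_proj ip X (r *\<^sub>R f) = r *\<^sub>R orth_proj ip X f"
  using orth_proj_smul[of "of_real r" f] unfolding scale_of_real .

section \<open>Riesz representation and adjoints on closed subspaces\<close>

lemma riesz_representation:
  assumes add: "\<And>x y. x \<in> X \<Longrightarrow> y \<in> X \<Longrightarrow> \<phi> (x + y) = \<phi> x + \<phi> y"
    and scale: "\<And>c x. x \<in> X \<Longrightarrow> \<phi> (smul c x) = c * \<phi> x"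
    and bound: "\<And>x. x \<in> X \<Longrightarrow> norm (\<phi> x) \<le> C * norm x"
  shows "\<exists>z\<in>X. \<forall>x\<in>X. \<phi> x = ip x z"
proof (cases "\<forall>x\<in>X. \<phi> x = 0")
  case True
  then show ?thesis using subspace_0[OF X] by (metis ip_zero_right)
next
  case False
  then obtain x0 where x0: "x0 \<in> X" "\<phi> x0 \<noteq> 0" by blast
  define N where "N = {x \<in> X. \<phi> x = 0}"
  have diff: "\<phi> (x - y) = \<phi> x - \<phi> y" if "x \<in> X" "y \<in> X" for x y
    using add[of "x - y" y] that subspace_diff[OF X] by simp
  have "\<phi> 0 = 0" using add[of 0 0] subspace_0[OF X] by simp
  then have N: "subspace N"
    using X by (auto intro!: subspaceI simp: N_def subspace_0 subspace_add subspace_scale add scale)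
  \<comment> \<open>On a convergent sequence in the kernel, the value at the limit \<open>l\<close>
    equals the value at \<open>l - s n\<close>, which the bound on the functional sends to
    0.\<close>
  have "closed N"
  proof (unfold closed_sequential_limits, intro allI impI, elim conjE)
    fix s l assume s: "\<forall>n. s n \<in> N" and l: "s \<longlonglongrightarrow> l"
    have sX: "s n \<in> X" "\<phi> (s n) = 0" for n using s by (auto simp: N_def)
    have lX: "l \<in> X" using closed_sequentially[OF cl sX(1) l] .
    have "norm (\<phi> l) \<le> C * norm (l - s n)" for n
      using bound[OF subspace_diff[OF X lX sX(1)[of n]]] by (simp add: diff lX sX)
    moreover have "(\<lambda>n. C * norm (l - s n)) \<longlonglongrightarrow> C * norm (l - l)"
      by (intro tendsto_intros l)
    ultimately have "norm (\<phi> l) \<le> C * norm (l - l)"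
      by (intro LIMSEQ_le_const) auto
    then show "l \<in> N" using lX by (simp add: N_def)
  qed
  from exists_projection[OF N this, of x0]
  obtain p where p: "p \<in> N" and orth: "\<And>v. v \<in> N \<Longrightarrow> ip (x0 - p) v = 0" by blast
  define w where "w = x0 - p"
  have wX: "w \<in> X" using x0 p subspace_diff[OF X] by (auto simp: w_def N_def)
  have w: "\<phi> w \<noteq> 0" using x0 p by (simp add: w_def N_def diff)
  have w0: "w \<noteq> 0" using w \<open>\<phi> 0 = 0\<close> by auto
  define z where "z = smul (conj (\<phi> w) * of_real (1 / (norm w)\<^sup>2)) w"
  have "\<phi> x = ip x z" if x: "x \<in> X" for x
  proof -
    \<comment> \<open>This combination is annihilated by the functional, hence orthogonal to
      \<open>w\<close>. Expanding the orthogonality relation expresses the functional through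
      \<open>ip x w\<close> and explains the scaling factor in \<open>z\<close>.\<close>
    have "smul (\<phi> x) w - smul (\<phi> w) x \<in> N"
      using subspace_diff[OF X] subspace_scale[OF X] x wX by (simp add: N_def diff scale)
    from orth[OF this] have "ip (smul (\<phi> x) w - smul (\<phi> w) x) w = 0"
      by (metis ip_conj conj_zero w_def)
    then have "\<phi> x * of_real ((norm w)\<^sup>2) = \<phi> w * ip x w"
      by (simp add: ip_diff_left ip_scale_left ip_self)
    then show ?thesis
      using w0 by (simp add: z_def ip_scale_right conj_mult conj_conj del: of_real_divide)
        (simp add: field_simps)
  qed
  moreover have "z \<in> X" unfolding z_def by (rule subspace_scale[OF X wX])
  ultimately show ?thesis by blast
qed

lemma adjoint_from_eqI:
  assumes "z \<in> X" "\<And>x. x \<in> X \<Longrightarrow> ip (T x) y = ip x z"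
  shows "adjoint_from ip X T y = z"
  unfolding adjoint_from_def
proof (rule the_equality)
  fix z' assume z': "z' \<in> X \<and> (\<forall>x\<in>X. ip (T x) y = ip x z')"
  have "z' - z \<in> X" using z' assms subspace_diff[OF X] by blast
  then have "ip (z' - z) (z' - z) = 0" using z' assms(2) by (simp add: ip_diff_right)
  then show "z' = z" by simp
qed (use assms in blast)

text \<open>Linearity and boundedness are demanded on \<open>X\<close> only, because the map of
  interest, the inverse of the frame operator, is meaningful only on the image of
  \<open>range K\<close>. Riesz applied to the functional \<open>ip (T x) y\<close> gives the
  adjoint vector.\<close>

lemma adjoint_from:
  assumes "\<And>x y. x \<in> X \<Longrightarrow> y \<in> X \<Longrightarrow> T (x + y) = T x + T y"
    and "\<And>c x. x \<in> X \<Longrightarrow> T (smul c x) = smul c (T x)"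
    and "\<And>x. x \<in> X \<Longrightarrow> norm (T x) \<le> C * norm x"
  shows adjoint_from_in: "adjoint_from ip X T y \<in> X"
    and ip_adjoint_from: "x \<in> X \<Longrightarrow> ip (T x) y = ip x (adjoint_from ip X T y)"
proof -
  have ex: "\<exists>z\<in>X. \<forall>x\<in>X. ip (T x) y = ip x z"
  proof (rule riesz_representation)
    fix x assume "x \<in> X"
    then have "norm (ip (T x) y) \<le> (C * norm x) * norm y"
      using order_trans[OF Cauchy_Schwarz mult_right_mono[OF assms(3)]] by simp
    then show "norm (ip (T x) y) \<le> (C * norm y) * norm x" by (simp add: ac_simps)
  qed (simp_all add: assms ip_add_left ip_scale_left)
  then obtain z where z: "z \<in> X" "\<And>x. x \<in> X \<Longrightarrow> ip (T x) y = ip x z" by blast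
  have "adjoint_from ip X T y = z" by (rule adjoint_from_eqI[OF z])
  then show "adjoint_from ip X T y \<in> X" "x \<in> X \<Longrightarrow> ip (T x) y = ip x (adjoint_from ip X T y)"
    using z by simp_all
qed

lemma norm_adjoint_from_le:
  assumes "\<And>x y. x \<in> X \<Longrightarrow> y \<in> X \<Longrightarrow> T (x + y) = T x + T y"
    and "\<And>c x. x \<in> X \<Longrightarrow> T (smul c x) = smul c (T x)"
    and bound: "\<And>x. x \<in> X \<Longrightarrow> norm (T x) \<le> C * norm x"
    and "0 \<le> C"
  shows "norm (adjoint_from ip X T y) \<le> C * norm y"
proof -
  define z where "z = adjoint_from ip X T y"
  have z: "z \<in> X" "ip (T z) y = ip z z"
    using adjoint_from[of T C] assms by (auto simp: z_def)
  \<comment> \<open>Testing the adjoint relation at its own value \<open>z\<close> bounds the square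
    of the norm by \<open>C * norm z * norm y\<close>, and one factor cancels.\<close>
  have "norm z * norm z = norm (ip z z)"
    by (simp add: ip_self power2_eq_square norm_mult)
  also have "\<dots> = norm (ip (T z) y)" by (simp add: z)
  also have "\<dots> \<le> norm (T z) * norm y" by (rule Cauchy_Schwarz)
  also have "\<dots> \<le> (C * norm z) * norm y" by (intro mult_right_mono bound z) simp
  finally have "norm z * norm z \<le> norm z * (C * norm y)" by (simp add: ac_simps)
  then show ?thesis
    using \<open>0 \<le> C\<close> by (cases "z = 0") (simp_all add: z_def)
qed

end

section \<open>Synthesis bound and frame operator of a Bessel fusion sequence\<close>

context
  fixes I :: "'i set" and W :: "'i \<Rightarrow> 'h set" and \<omega> :: "'i \<Rightarrow> real" and B :: real
  assumes W: "\<And>i. i \<in> I \<Longrightarrow> subspace (W i)" "\<And>i. i \<in> I \<Longrightarrow> closed (W i)"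
    and summable: "\<And>f. (\<lambda>i. (\<omega> i)\<^sup>2 * (norm (orth_proj ip (W i) f))\<^sup>2) summable_on I"
    and bessel: "\<And>f. (\<Sum>\<^sub>\<infinity>i\<in>I. (\<omega> i)\<^sup>2 * (norm (orth_proj ip (W i) f))\<^sup>2) \<le> B * (norm f)\<^sup>2"
    and B: "0 \<le> B"
begin

text \<open>This is duality with the analysis map: pairing the sum \<open>s\<close> with itself
  moves each projection onto \<open>s\<close>, where the Bessel inequality applies after
  Cauchy-Schwarz over the index set. A factor of the squared norm of \<open>s\<close> then
  cancels.\<close>

lemma norm_synthesis_le:
  assumes F: "finite F" "F \<subseteq> I"
  shows "(norm (\<Sum>i\<in>F. \<omega> i *\<^sub>R orth_proj ip (W i) (u i)))\<^sup>2 \<le> B * (\<Sum>i\<in>F. (norm (u i))\<^sup>2)"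
proof -
  define s where "s = (\<Sum>i\<in>F. \<omega> i *\<^sub>R orth_proj ip (W i) (u i))"
  define c where "c i = \<bar>\<omega> i\<bar> * norm (orth_proj ip (W i) s)" for i
  have "ip s s = (\<Sum>i\<in>F. of_real (\<omega> i) * ip (u i) (orth_proj ip (W i) s))"
    unfolding s_def ip_sum_left
    by (intro sum.cong refl) (use F W in \<open>auto simp: ip_scaleR_left ip_orth_proj_commute subset_iff\<close>)
  then have "(norm s)\<^sup>2 = norm (\<Sum>i\<in>F. of_real (\<omega> i) * ip (u i) (orth_proj ip (W i) s))"
    by (metis ip_self norm_of_real abs_of_nonneg zero_le_power2)
  also have "\<dots> \<le> (\<Sum>i\<in>F. norm (u i) * c i)"
  proof (rule sum_norm_le)
    fix i
    show "norm (of_real (\<omega> i) * ip (u i) (orth_proj ip (W i) s)) \<le> norm (u i) * c i"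
      using mult_left_mono[OF Cauchy_Schwarz[of "u i" "orth_proj ip (W i) s"], of "\<bar>\<omega> i\<bar>"]
      by (simp add: norm_mult c_def ac_simps)
  qed
  finally have "((norm s)\<^sup>2)\<^sup>2 \<le> (\<Sum>i\<in>F. norm (u i) * c i)\<^sup>2"
    by (rule power_mono) simp
  also have "\<dots> \<le> (\<Sum>i\<in>F. (norm (u i))\<^sup>2) * (\<Sum>i\<in>F. (c i)\<^sup>2)"
    by (rule Cauchy_Schwarz_ineq_sum)
  also have "\<dots> \<le> (\<Sum>i\<in>F. (norm (u i))\<^sup>2) * (B * (norm s)\<^sup>2)"
    unfolding c_def power_mult_distrib power2_abs
    by (intro mult_left_mono order_trans[OF finite_sum_le_infsum[OF summable F] bessel])
      (simp_all add: sum_nonneg)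
  finally have "(norm s)\<^sup>2 * (norm s)\<^sup>2 \<le> (norm s)\<^sup>2 * (B * (\<Sum>i\<in>F. (norm (u i))\<^sup>2))"
    by (simp only: power2_eq_square[of "(norm s)\<^sup>2"] ac_simps)
  then have "(norm s)\<^sup>2 \<le> B * (\<Sum>i\<in>F. (norm (u i))\<^sup>2)" if "s \<noteq> 0"
    by (rule mult_left_le_imp_le) (use that in simp)
  then show ?thesis
    unfolding s_def[symmetric] using B by (cases "s = 0") (simp_all add: sum_nonneg)
qed

text \<open>By idempotence, one of the two weights can be moved inside the projection, which gives a
  synthesis sum. The right side keeps only the terms in \<open>F\<close>, as the Cauchy criterion
  for the frame operator requires.\<close>

lemma norm_partial_frame_operator_le:
  assumes F: "finite F" "F \<subseteq> I"
  shows "(norm (\<Sum>i\<in>F. (\<omega> i)\<^sup>2 *\<^sub>R orth_proj ip (W i) f))\<^sup>2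
    \<le> B * (\<Sum>i\<in>F. (\<omega> i)\<^sup>2 * (norm (orth_proj ip (W i) f))\<^sup>2)"
proof -
  have "(\<Sum>i\<in>F. (\<omega> i)\<^sup>2 *\<^sub>R orth_proj ip (W i) f)
      = (\<Sum>i\<in>F. \<omega> i *\<^sub>R orth_proj ip (W i) (\<omega> i *\<^sub>R orth_proj ip (W i) f))"
    by (rule sum.cong) (use F W in \<open>auto simp: orth_proj_scaleR orth_proj_idem power2_eq_square\<close>)
  then show ?thesis
    using norm_synthesis_le[OF F, of "\<lambda>i. \<omega> i *\<^sub>R orth_proj ip (W i) f"]
    by (simp add: power_mult_distrib)
qed

lemma frame_operator_has_sum:
  "((\<lambda>i. (\<omega> i)\<^sup>2 *\<^sub>R orth_proj ip (W i) f) has_sum frame_operator ip I W \<omega> f) I"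
  unfolding frame_operator_def
  by (rule has_sum_infsum, rule summable_on_if_norm_sum_sq_le[OF summable])
    (use norm_partial_frame_operator_le B in auto)

lemma frame_operator_add:
  "frame_operator ip I W \<omega> (f + g) = frame_operator ip I W \<omega> f + frame_operator ip I W \<omega> g"
proof -
  have "frame_operator ip I W \<omega> (f + g)
      = (\<Sum>\<^sub>\<infinity>i\<in>I. (\<omega> i)\<^sup>2 *\<^sub>R orth_proj ip (W i) f + (\<omega> i)\<^sup>2 *\<^sub>R orth_proj ip (W i) g)"
    unfolding frame_operator_def by (rule infsum_cong) (simp add: W orth_proj_add scaleR_add_right)
  also have "\<dots> = frame_operator ip I W \<omega> f + frame_operator ip I W \<omega> g"
    by (rule infsumI[OF has_sum_add[OF frame_operator_has_sum frame_operator_has_sum]])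
  finally show ?thesis .
qed

lemma frame_operator_smul:
  "frame_operator ip I W \<omega> (smul c f) = smul c (frame_operator ip I W \<omega> f)"
proof -
  have bl: "bounded_linear (smul c)"
    by (rule bounded_linear_intro[where K = "norm c"])
      (simp_all add: scale_right_distrib smul_scaleR norm_smul mult.commute)
  have "frame_operator ip I W \<omega> (smul c f)
      = (\<Sum>\<^sub>\<infinity>i\<in>I. smul c ((\<omega> i)\<^sup>2 *\<^sub>R orth_proj ip (W i) f))"
    unfolding frame_operator_def by (rule infsum_cong) (simp add: W orth_proj_smul smul_scaleR)
  also have "\<dots> = smul c (frame_operator ip I W \<omega> f)"
    by (rule infsumI[OF has_sum_bounded_linear[OF bl frame_operator_has_sum]])
  finally show ?thesis .
qed

text \<open>Projections are self-adjoint and idempotent, so pairing the series with \<open>f\<close>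
  term by term yields the fusion frame sum. Frame bounds thereby become bounds on the quadratic form
  of the frame operator.\<close>

lemma ip_frame_operator_self:
  "ip (frame_operator ip I W \<omega> f) f
    = of_real (\<Sum>\<^sub>\<infinity>i\<in>I. (\<omega> i)\<^sup>2 * (norm (orth_proj ip (W i) f))\<^sup>2)"
proof -
  have 1: "((\<lambda>i. ip ((\<omega> i)\<^sup>2 *\<^sub>R orth_proj ip (W i) f) f) has_sum ip (frame_operator ip I W \<omega> f) f) I"
    by (rule has_sum_bounded_linear[OF bounded_linear_ip_left frame_operator_has_sum])
  have 2: "((\<lambda>i. of_real ((\<omega> i)\<^sup>2 * (norm (orth_proj ip (W i) f))\<^sup>2) :: 'k) has_sum
      of_real (\<Sum>\<^sub>\<infinity>i\<in>I. (\<omega> i)\<^sup>2 * (norm (orth_proj ip (W i) f))\<^sup>2)) I"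
    by (rule has_sum_bounded_linear[OF bounded_linear_of_real has_sum_infsum[OF summable]])
  have "((\<lambda>i. ip ((\<omega> i)\<^sup>2 *\<^sub>R orth_proj ip (W i) f) f) has_sum
      of_real (\<Sum>\<^sub>\<infinity>i\<in>I. (\<omega> i)\<^sup>2 * (norm (orth_proj ip (W i) f))\<^sup>2)) I"
    by (rule iffD1[OF has_sum_cong 2]) (simp add: W ip_scaleR_left ip_orth_proj_self)
  with 1 show ?thesis by (rule has_sum_unique)
qed

text \<open>\<open>B\<close> enters the squared estimate twice, once from the synthesis bound and
  once from the Bessel inequality for \<open>f\<close>. The estimate on finite partial sums passes
  to the limit.\<close>

lemma norm_frame_operator_le: "norm (frame_operator ip I W \<omega> f) \<le> B * norm f"
proof -
  define g where "g = (\<lambda>i. (\<omega> i)\<^sup>2 * (norm (orth_proj ip (W i) f))\<^sup>2)"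
  have "((\<lambda>F. (norm (\<Sum>i\<in>F. (\<omega> i)\<^sup>2 *\<^sub>R orth_proj ip (W i) f))\<^sup>2)
      \<longlongrightarrow> (norm (frame_operator ip I W \<omega> f))\<^sup>2) (finite_subsets_at_top I)"
    by (intro tendsto_intros frame_operator_has_sum[unfolded has_sum_def])
  moreover have "\<forall>\<^sub>F F in finite_subsets_at_top I.
      (norm (\<Sum>i\<in>F. (\<omega> i)\<^sup>2 *\<^sub>R orth_proj ip (W i) f))\<^sup>2 \<le> (B * norm f)\<^sup>2"
  proof (rule eventually_finite_subsets_at_top_weakI)
    fix F assume F: "finite F" "F \<subseteq> I"
    have "sum g F \<le> B * (norm f)\<^sup>2"
      using finite_sum_le_infsum[OF summable[of f] F] bessel[of f] by (simp add: g_def)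
    then have "B * sum g F \<le> B * (B * (norm f)\<^sup>2)" using B by (rule mult_left_mono)
    with norm_partial_frame_operator_le[OF F, of f]
    show "(norm (\<Sum>i\<in>F. (\<omega> i)\<^sup>2 *\<^sub>R orth_proj ip (W i) f))\<^sup>2 \<le> (B * norm f)\<^sup>2"
      by (simp add: g_def power2_eq_square ac_simps)
  qed
  ultimately have "(norm (frame_operator ip I W \<omega> f))\<^sup>2 \<le> (B * norm f)\<^sup>2"
    by (rule tendsto_upperbound) simp
  then show ?thesis by (rule power2_le_imp_le) (simp add: B)
qed

lemma bounded_linear_frame_operator: "bounded_linear (frame_operator ip I W \<omega>)"
proof (rule bounded_linear_intro[where K = B])
  show "frame_operator ip I W \<omega> (r *\<^sub>R f) = r *\<^sub>R frame_operator ip I W \<omega> f" for r f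
    using frame_operator_smul[of "of_real r" f] unfolding scale_of_real .
  show "norm (frame_operator ip I W \<omega> f) \<le> norm f * B" for f
    by (subst mult.commute) (rule norm_frame_operator_le)
qed (rule frame_operator_add)

end

lemma has_K_left_inverse_self: "has_K_left_inverse smul K K"
proof -
  have "bounded_operator smul id"
    unfolding bounded_operator_def id_def by (simp add: linear_ident bounded_linear_ident)
  then show ?thesis unfolding has_K_left_inverse_def by (metis id_comp)
qed

section \<open>Bounded operators, their adjoints, and closed range\<close>

context
  fixes K :: "'h \<Rightarrow> 'h"
  assumes K: "bounded_operator smul K"
begin

lemma bounded_operator_add: "K (x + y) = K x + K y"
  and bounded_operator_smul: "K (smul c x) = smul c (K x)"
  and bounded_operator_bound: "\<exists>k\<ge>0. \<forall>x. norm (K x) \<le> k * norm x"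
proof -
  have lin: "Vector_Spaces.linear smul smul K" and bl: "bounded_linear K"
    using K by (auto simp: bounded_operator_def)
  interpret Vector_Spaces.linear smul smul K by (rule lin)
  show "K (x + y) = K x + K y" "K (smul c x) = smul c (K x)"
    by (rule add scale)+
  show "\<exists>k\<ge>0. \<forall>x. norm (K x) \<le> k * norm x"
    using bounded_linear.nonneg_bounded[OF bl] by (simp add: mult.commute)
qed

lemma subspace_range_bounded_operator: "subspace (range K)"
proof (rule subspaceI)
  show "0 \<in> range K"
    using bounded_operator_add[of 0 0] by (intro image_eqI[of _ _ 0]) simp_all
qed (auto simp flip: bounded_operator_add bounded_operator_smul)

lemma ip_hilbert_adjoint: "ip (K x) y = ip x (hilbert_adjoint ip K y)"
proof -
  obtain k where "\<And>x. norm (K x) \<le> k * norm x" using bounded_operator_bound by blast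
  then show ?thesis
    by (intro ip_adjoint_from[OF subspace_UNIV closed_UNIV, of K k])
      (simp_all add: bounded_operator_add bounded_operator_smul)
qed

text \<open>Turns the lower bound of a fusion frame for the adjoint of \<open>K\<close>, which is
  stated with a second adjoint, into a bound on \<open>norm (K f)\<close>.\<close>

lemma hilbert_adjoint_hilbert_adjoint: "hilbert_adjoint ip (hilbert_adjoint ip K) = K"
proof
  fix y
  have "ip (hilbert_adjoint ip K x) y = ip x (K y)" for x
    by (metis ip_hilbert_adjoint ip_conj)
  then show "hilbert_adjoint ip (hilbert_adjoint ip K) y = K y"
    by (intro adjoint_from_eqI[OF subspace_UNIV closed_UNIV]) simp_all
qed

text \<open>The normalised functionals \<open>y \<mapsto> \<langle>y, f\<rangle> / \<parallel>K\<^sup>* f\<parallel>\<close> are pointwise bounded on the range of \<open>K\<close>,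
  so the uniform boundedness principle replaces the open mapping theorem.\<close>

lemma norm_le_hilbert_adjoint_on_range:
  assumes cl: "closed (range K)"
  shows "\<exists>C\<ge>0. \<forall>f\<in>range K. norm f \<le> C * norm (hilbert_adjoint ip K f)"
proof -
  define n where "n f = norm (hilbert_adjoint ip K f)" for f
  \<comment> \<open>If \<open>n f = 0\<close>, then \<open>inverse (n f) = 0\<close> and the
    functional is zero, so the family can be indexed by all \<open>f\<close>.\<close>
  define \<Phi> where "\<Phi> = range (\<lambda>f y. inverse (n f) *\<^sub>R ip y f)"
  have pointwise: "norm (inverse (n f) *\<^sub>R ip (K x) f) \<le> norm x" for f x
  proof -
    have "norm (ip (K x) f) \<le> norm x * n f"
      unfolding ip_hilbert_adjoint n_def by (rule Cauchy_Schwarz)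
    then have "inverse (n f) * norm (ip (K x) f) \<le> inverse (n f) * (norm x * n f)"
      by (rule mult_left_mono) (simp add: n_def)
    also have "\<dots> \<le> norm x" by (cases "n f = 0") (simp_all add: field_simps)
    finally show ?thesis by (simp add: n_def)
  qed
  have "\<exists>C\<ge>0. \<forall>\<phi>\<in>\<Phi>. \<forall>y\<in>range K. norm (\<phi> y) \<le> C * norm y"
  proof (rule uniform_boundedness_on_closed_subspace
      [OF real_subspace[OF subspace_range_bounded_operator] cl])
    show "bounded_linear \<phi>" if "\<phi> \<in> \<Phi>" for \<phi>
      using that
      by (auto simp: \<Phi>_def
          intro: bounded_linear_compose[OF bounded_linear_scaleR_right bounded_linear_ip_left])
    show "bounded ((\<lambda>\<phi>. \<phi> y) ` \<Phi>)" if "y \<in> range K" for y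
      using that pointwise by (auto simp: \<Phi>_def bounded_iff)
  qed
  then obtain C where C: "C \<ge> 0" "\<And>f y. y \<in> range K \<Longrightarrow> norm (inverse (n f) *\<^sub>R ip y f) \<le> C * norm y"
    by (auto simp: \<Phi>_def)
  have "norm f \<le> C * n f" if f: "f \<in> range K" for f
  proof (cases "n f = 0")
    \<comment> \<open>Here the normalised functional carries no information. Writing
      \<open>f = K x\<close> instead gives \<open>ip f f = 0\<close> directly.\<close>
    case True
    obtain x where "f = K x" using f by blast
    then have "ip f f = ip x (hilbert_adjoint ip K f)" by (simp add: ip_hilbert_adjoint)
    then show ?thesis using True by (simp add: n_def)
  next
    case False
    then have pos: "n f > 0" by (simp add: n_def)
    \<comment> \<open>The uniform bound is evaluated at the vector \<open>f\<close> itself, which is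
      allowed because \<open>f\<close> lies in \<open>range K\<close>.\<close>
    from C(2)[OF f, of f] have "inverse (n f) * (norm f * norm f) \<le> C * norm f"
      using pos by (simp add: ip_self norm_mult power2_eq_square)
    then have "norm f * norm f \<le> norm f * (C * n f)"
      using pos by (simp add: field_simps)
    then show ?thesis using C pos by (cases "f = 0") simp_all
  qed
  with C(1) show ?thesis unfolding n_def by blast
qed

section \<open>Bounds for the inverse of the frame operator and for the multiplier\<close>

context
  fixes I :: "'i set" and W :: "'i \<Rightarrow> 'h set" and \<omega> :: "'i \<Rightarrow> real"
  assumes cl: "closed (range K)" and frame: "fusion_frame_for smul ip K I W \<omega>"
begin

lemma frame_operator_bounded_below:
  "\<exists>c>0. \<forall>f\<in>range K. c * norm f \<le> norm (frame_operator ip I W \<omega> f)"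
proof -
  define s where "s f = (\<Sum>\<^sub>\<infinity>i\<in>I. (\<omega> i)\<^sup>2 * (norm (orth_proj ip (W i) f))\<^sup>2)" for f
  obtain A B where AB: "0 < A" "A \<le> B"
    and bounds: "\<And>f. (\<lambda>i. (\<omega> i)\<^sup>2 * (norm (orth_proj ip (W i) f))\<^sup>2) summable_on I"
      "\<And>f. A * (norm (hilbert_adjoint ip K f))\<^sup>2 \<le> s f" "\<And>f. s f \<le> B * (norm f)\<^sup>2"
    and W: "\<And>i. i \<in> I \<Longrightarrow> subspace (W i)" "\<And>i. i \<in> I \<Longrightarrow> closed (W i)"
    using frame unfolding fusion_frame_for_def weighted_subspaces_def s_def by blast
  obtain C where C: "C \<ge> 0" "\<And>f. f \<in> range K \<Longrightarrow> norm f \<le> C * norm (hilbert_adjoint ip K f)"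
    using norm_le_hilbert_adjoint_on_range[OF cl] by blast
  have B: "0 \<le> B" using AB by simp
  have "A * norm f \<le> C\<^sup>2 * norm (frame_operator ip I W \<omega> f)" if f: "f \<in> range K" for f
  proof -
    have "of_real (s f) = ip (frame_operator ip I W \<omega> f) f"
      unfolding s_def
      by (rule ip_frame_operator_self[OF W bounds(1) bounds(3)[unfolded s_def] B, symmetric])
    then have "\<bar>s f\<bar> = norm (ip (frame_operator ip I W \<omega> f) f)"
      by (metis norm_of_real)
    then have s: "s f \<le> norm (frame_operator ip I W \<omega> f) * norm f"
      using Cauchy_Schwarz[of "frame_operator ip I W \<omega> f" f] by linarith
    have "A * (norm f)\<^sup>2 \<le> A * (C * norm (hilbert_adjoint ip K f))\<^sup>2"
      using AB by (intro mult_left_mono power_mono C f) simp_all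
    also have "\<dots> = C\<^sup>2 * (A * (norm (hilbert_adjoint ip K f))\<^sup>2)"
      by (simp add: power_mult_distrib)
    also have "\<dots> \<le> C\<^sup>2 * (norm (frame_operator ip I W \<omega> f) * norm f)"
      by (intro mult_left_mono order_trans[OF bounds(2) s]) simp
    finally have "norm f * (A * norm f) \<le> norm f * (C\<^sup>2 * norm (frame_operator ip I W \<omega> f))"
      by (simp add: power2_eq_square ac_simps)
    then show ?thesis by (cases "f = 0") simp_all
  qed
  \<comment> \<open>Adding 1 makes the factor positive, so that it can be divided out even when
    \<open>C = 0\<close>.\<close>
  then have "A * norm f \<le> (C\<^sup>2 + 1) * norm (frame_operator ip I W \<omega> f)" if "f \<in> range K" for f
    by (rule order_trans) (use that in \<open>simp_all add: distrib_right\<close>)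
  then have "A / (C\<^sup>2 + 1) * norm f \<le> norm (frame_operator ip I W \<omega> f)" if "f \<in> range K" for f
    using that by (simp add: pos_divide_le_eq add_nonneg_pos mult.commute)
  moreover have "A / (C\<^sup>2 + 1) > 0" using AB by (simp add: add_nonneg_pos)
  ultimately show ?thesis by blast
qed

text \<open>The lower bound \<open>c\<close> of the frame operator on \<open>range K\<close> bounds
  its inverse by \<open>1 / c\<close>, and passing to the adjoint keeps this constant. The estimate
  holds for every \<open>y\<close>, since the Riesz vector defining the adjoint exists for every
  \<open>y\<close>.\<close>

lemma frame_operator_inverse_adjoint_bounded:
  "\<exists>C\<ge>0. \<forall>y. norm (frame_operator_inverse_adjoint ip K I W \<omega> y) \<le> C * norm y"
proof -
  let ?S = "frame_operator ip I W \<omega>"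
  let ?T = "frame_operator_inverse ip K I W \<omega>"
  obtain B where B: "0 \<le> B"
    and bounds: "\<And>f. (\<lambda>i. (\<omega> i)\<^sup>2 * (norm (orth_proj ip (W i) f))\<^sup>2) summable_on I"
      "\<And>f. (\<Sum>\<^sub>\<infinity>i\<in>I. (\<omega> i)\<^sup>2 * (norm (orth_proj ip (W i) f))\<^sup>2) \<le> B * (norm f)\<^sup>2"
    and W: "\<And>i. i \<in> I \<Longrightarrow> subspace (W i)" "\<And>i. i \<in> I \<Longrightarrow> closed (W i)"
    using frame unfolding fusion_frame_for_def weighted_subspaces_def by (meson less_imp_le order_trans)
  have add: "?S (f + g) = ?S f + ?S g" for f g
    by (rule frame_operator_add[OF W bounds B])
  have smul: "?S (smul a f) = smul a (?S f)" for a f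
    by (rule frame_operator_smul[OF W bounds B])
  have bl: "bounded_linear ?S"
    by (rule bounded_linear_frame_operator[OF W bounds B])
  have R: "subspace (range K)" by (rule subspace_range_bounded_operator)
  obtain c where c: "c > 0" "\<And>f. f \<in> range K \<Longrightarrow> c * norm f \<le> norm (?S f)"
    using frame_operator_bounded_below by blast
  \<comment> \<open>Injectivity ensures that \<open>inv_into\<close> recovers each original vector
    of \<open>range K\<close> from its image.\<close>
  have "inj_on ?S (range K)"
  proof (rule inj_onI)
    fix f g assume fg: "f \<in> range K" "g \<in> range K" "?S f = ?S g"
    then have "?S (f - g) = 0" using linear_diff[OF bounded_linear.linear[OF bl]] by simp
    then have "c * norm (f - g) \<le> 0" using c(2)[OF subspace_diff[OF R fg(1,2)]] by simp
    then show "f = g" using c(1) by (simp add: mult_le_0_iff)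
  qed
  then have T: "?T (?S f) = f" if "f \<in> range K" for f
    unfolding frame_operator_inverse_def using that by (rule inv_into_f_f)
  have X: "subspace (?S ` range K)"
  proof (rule subspaceI)
    show "0 \<in> ?S ` range K"
      using linear_0[OF bounded_linear.linear[OF bl], symmetric] subspace_0[OF R] by (rule image_eqI)
  next
    fix x y assume "x \<in> ?S ` range K" "y \<in> ?S ` range K"
    then obtain f g where "f \<in> range K" "g \<in> range K" "x = ?S f" "y = ?S g" by blast
    then show "x + y \<in> ?S ` range K"
      by (simp only: imageI subspace_add[OF R] flip: add)
  next
    fix a x assume "x \<in> ?S ` range K"
    then obtain f where "f \<in> range K" "x = ?S f" by blast
    then show "smul a x \<in> ?S ` range K"
      by (simp only: imageI subspace_scale[OF R] flip: smul)
  qed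
  \<comment> \<open>A bounded linear map that is bounded below on a complete subspace has complete
    image. Closedness of the image is needed for the adjoint to exist on it.\<close>
  have "complete (?S ` range K)"
    by (rule complete_isometric_image[OF c(1) real_subspace[OF R] bl])
      (use c cl in \<open>auto simp: complete_eq_closed\<close>)
  then have clX: "closed (?S ` range K)" by (simp add: complete_eq_closed)
  have "norm (frame_operator_inverse_adjoint ip K I W \<omega> y) \<le> (1 / c) * norm y" for y
    unfolding frame_operator_inverse_adjoint_def
  proof (rule norm_adjoint_from_le[OF X clX])
    fix x y assume "x \<in> ?S ` range K" "y \<in> ?S ` range K"
    then obtain f g where "f \<in> range K" "g \<in> range K" "x = ?S f" "y = ?S g" by blast
    then show "?T (x + y) = ?T x + ?T y" by (simp only: T subspace_add[OF R] flip: add)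
  next
    fix a x assume "x \<in> ?S ` range K"
    then obtain f where "f \<in> range K" "x = ?S f" by blast
    then show "?T (smul a x) = smul a (?T x)" by (simp only: T subspace_scale[OF R] flip: smul)
  next
    fix x assume "x \<in> ?S ` range K"
    then obtain f where f: "f \<in> range K" "x = ?S f" by blast
    then have "c * norm f \<le> norm x" using c by simp
    then show "norm (?T x) \<le> (1 / c) * norm x"
      using c(1) by (simp only: f T) (simp add: field_simps)
  qed (use c in simp)
  then show ?thesis using c(1) by (intro exI[of _ "1 / c"]) simp
qed

text \<open>The multiplier is a synthesis sum for \<open>W\<close> whose coefficient vectors have
  norms controlled by \<open>\<upsilon> i * norm (orth_proj ip (V i) f)\<close>. Keeping the fusion
  sum of \<open>V\<close> on the right, instead of estimating it by the norm of \<open>f\<close>, is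
  what later produces a lower bound.\<close>

lemma fusion_multiplier_bounded:
  assumes m: "bounded (m ` I)"
    and V: "\<And>f. (\<lambda>i. (\<upsilon> i)\<^sup>2 * (norm (orth_proj ip (V i) f))\<^sup>2) summable_on I"
  shows "\<exists>D\<ge>0. \<forall>f. (norm (fusion_multiplier smul ip K I m W \<omega> V \<upsilon> f))\<^sup>2
    \<le> D * (\<Sum>\<^sub>\<infinity>i\<in>I. (\<upsilon> i)\<^sup>2 * (norm (orth_proj ip (V i) f))\<^sup>2)"
proof -
  let ?T = "frame_operator_inverse_adjoint ip K I W \<omega>"
  obtain B where B: "0 \<le> B"
    and bounds: "\<And>f. (\<lambda>i. (\<omega> i)\<^sup>2 * (norm (orth_proj ip (W i) f))\<^sup>2) summable_on I"
      "\<And>f. (\<Sum>\<^sub>\<infinity>i\<in>I. (\<omega> i)\<^sup>2 * (norm (orth_proj ip (W i) f))\<^sup>2) \<le> B * (norm f)\<^sup>2"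
    and W: "\<And>i. i \<in> I \<Longrightarrow> subspace (W i)" "\<And>i. i \<in> I \<Longrightarrow> closed (W i)"
    using frame unfolding fusion_frame_for_def weighted_subspaces_def by (meson less_imp_le order_trans)
  obtain C where C: "C \<ge> 0" "\<And>y. norm (?T y) \<le> C * norm y"
    using frame_operator_inverse_adjoint_bounded by blast
  obtain k where k: "k \<ge> 0" "\<And>y. norm (K y) \<le> k * norm y"
    using bounded_operator_bound by blast
  obtain a where a: "a > 0" "\<And>i. i \<in> I \<Longrightarrow> norm (m i) \<le> a"
    using m unfolding bounded_pos by blast
  \<comment> \<open>\<open>B\<close> comes from the synthesis bound; \<open>a\<close>,
    \<open>C\<close> and \<open>k\<close> bound the symbol, the adjoint inverse and
    \<open>K\<close>.\<close>
  define D where "D = B * (a * (C * k))\<^sup>2"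
  have "(norm (fusion_multiplier smul ip K I m W \<omega> V \<upsilon> f))\<^sup>2
    \<le> D * (\<Sum>\<^sub>\<infinity>i\<in>I. (\<upsilon> i)\<^sup>2 * (norm (orth_proj ip (V i) f))\<^sup>2)" for f
  proof -
    define p where "p i = orth_proj ip (V i) f" for i
    define s where "s = (\<Sum>\<^sub>\<infinity>i\<in>I. (\<upsilon> i)\<^sup>2 * (norm (p i))\<^sup>2)"
    define u where "u i = smul (m i * of_real (\<upsilon> i)) (?T (K (p i)))" for i
    define t where "t i = smul (m i * of_real (\<omega> i) * of_real (\<upsilon> i))
      (orth_proj ip (W i) (?T (K (p i))))" for i
    have s0: "0 \<le> D * s"
      unfolding D_def s_def using B by (intro mult_nonneg_nonneg infsum_nonneg) simp_all
    have u: "(norm (u i))\<^sup>2 \<le> (a * (C * k))\<^sup>2 * ((\<upsilon> i)\<^sup>2 * (norm (p i))\<^sup>2)" if "i \<in> I" for i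
    proof -
      have "norm (?T (K (p i))) \<le> C * (k * norm (p i))"
        by (rule order_trans[OF C(2) mult_left_mono[OF k(2) C(1)]])
      then have "norm (m i) * \<bar>\<upsilon> i\<bar> * norm (?T (K (p i))) \<le> a * \<bar>\<upsilon> i\<bar> * (C * (k * norm (p i)))"
        using a that by (intro mult_mono) simp_all
      then have "norm (u i) \<le> (a * (C * k)) * (\<bar>\<upsilon> i\<bar> * norm (p i))"
        by (simp add: u_def norm_smul norm_mult ac_simps)
      then have "(norm (u i))\<^sup>2 \<le> ((a * (C * k)) * (\<bar>\<upsilon> i\<bar> * norm (p i)))\<^sup>2"
        by (rule power_mono) simp
      then show ?thesis by (simp add: power_mult_distrib)
    qed
    have finite_le: "(norm (sum t F))\<^sup>2 \<le> D * s" if F: "finite F" "F \<subseteq> I" for F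
    proof -
      \<comment> \<open>The scalars \<open>m i\<close> and \<open>\<upsilon> i\<close> move inside
        the projection, leaving only the weight of \<open>W\<close> outside as the synthesis bound
        expects.\<close>
      have "t i = \<omega> i *\<^sub>R orth_proj ip (W i) (u i)" if "i \<in> I" for i
        unfolding t_def u_def orth_proj_smul[OF W[OF that]] scale_of_real[symmetric]
        by (simp add: ac_simps)
      then have "sum t F = (\<Sum>i\<in>F. \<omega> i *\<^sub>R orth_proj ip (W i) (u i))"
        using F by (intro sum.cong) auto
      then have "(norm (sum t F))\<^sup>2 \<le> B * (\<Sum>i\<in>F. (norm (u i))\<^sup>2)"
        by (simp only: norm_synthesis_le[OF W bounds B F])
      also have "\<dots> \<le> B * (\<Sum>i\<in>F. (a * (C * k))\<^sup>2 * ((\<upsilon> i)\<^sup>2 * (norm (p i))\<^sup>2))"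
        using F B by (intro mult_left_mono sum_mono u) auto
      also have "\<dots> = D * (\<Sum>i\<in>F. (\<upsilon> i)\<^sup>2 * (norm (p i))\<^sup>2)"
        by (simp add: D_def flip: sum_distrib_left)
      also have "\<dots> \<le> D * s"
        unfolding s_def p_def using B
        by (intro mult_left_mono finite_sum_le_infsum V F) (simp_all add: D_def)
      finally show ?thesis .
    qed
    have "(norm (\<Sum>\<^sub>\<infinity>i\<in>I. t i))\<^sup>2 \<le> D * s"
    proof (cases "t summable_on I")
      case True
      then have "(sum t \<longlongrightarrow> infsum t I) (finite_subsets_at_top I)"
        using has_sum_infsum unfolding has_sum_def by blast
      then have "((\<lambda>F. (norm (sum t F))\<^sup>2) \<longlongrightarrow> (norm (infsum t I))\<^sup>2) (finite_subsets_at_top I)"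
        by (intro tendsto_intros)
      then show ?thesis
        by (rule tendsto_upperbound)
          (auto intro: eventually_finite_subsets_at_top_weakI finite_le)
    next
      \<comment> \<open>The value of \<open>infsum\<close> is then 0, and the estimate reduces to
        nonnegativity of \<open>D * s\<close>.\<close>
      case False
      then show ?thesis using s0 by (simp add: infsum_not_exists)
    qed
    then show ?thesis by (simp add: fusion_multiplier_def t_def s_def p_def)
  qed
  moreover have "0 \<le> D" using B by (simp add: D_def)
  ultimately show ?thesis by blast
qed

lemma K_dual_fusion_frame:
  assumes V: "bessel_fusion_sequence smul ip I V \<upsilon>" and m: "bounded (m ` I)"
    and left_inverse: "has_K_left_inverse smul K (fusion_multiplier smul ip K I m W \<omega> V \<upsilon>)"
  shows "fusion_frame_for smul ip (hilbert_adjoint ip K) I V \<upsilon>"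
proof -
  let ?M = "fusion_multiplier smul ip K I m W \<omega> V \<upsilon>"
  define s where "s f = (\<Sum>\<^sub>\<infinity>i\<in>I. (\<upsilon> i)\<^sup>2 * (norm (orth_proj ip (V i) f))\<^sup>2)" for f
  obtain B where ws: "weighted_subspaces smul I V \<upsilon>"
    and summable: "\<And>f. (\<lambda>i. (\<upsilon> i)\<^sup>2 * (norm (orth_proj ip (V i) f))\<^sup>2) summable_on I"
    and B: "\<And>f. s f \<le> B * (norm f)\<^sup>2"
    using V unfolding bessel_fusion_sequence_def s_def by blast
  obtain D where D: "D \<ge> 0" "\<And>f. (norm (?M f))\<^sup>2 \<le> D * s f"
    using fusion_multiplier_bounded[OF m summable] unfolding s_def by blast
  obtain L where L: "bounded_linear L" "L \<circ> ?M = K"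
    using left_inverse unfolding has_K_left_inverse_def bounded_operator_def by blast
  obtain l where l: "l \<ge> 0" "\<And>f. norm (L f) \<le> norm f * l"
    using bounded_linear.nonneg_bounded[OF L(1)] by blast
  have s0: "0 \<le> s f" for f unfolding s_def by (rule infsum_nonneg) simp
  \<comment> \<open>The chain \<open>K f = L (?M f)\<close> bounds
    \<open>(norm (K f))\<^sup>2\<close> by \<open>l\<^sup>2 * D * s f\<close>. The extra 1 keeps the
    denominator positive.\<close>
  define A where "A = 1 / (l\<^sup>2 * D + 1)"
  have A: "A > 0" using D by (simp add: A_def add_nonneg_pos)
  have lower: "A * (norm (K f))\<^sup>2 \<le> s f" for f
  proof -
    have "K f = L (?M f)" using L(2) by (metis comp_apply)
    then have "(norm (K f))\<^sup>2 \<le> (norm (?M f) * l)\<^sup>2"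
      using l by (simp add: power_mono)
    also have "\<dots> = l\<^sup>2 * (norm (?M f))\<^sup>2" by (simp add: power_mult_distrib)
    also have "\<dots> \<le> l\<^sup>2 * (D * s f)" by (intro mult_left_mono D) simp
    also have "\<dots> \<le> (l\<^sup>2 * D + 1) * s f" using s0[of f] by (simp add: algebra_simps)
    finally show ?thesis
      using D by (simp add: A_def pos_divide_le_eq add_nonneg_pos mult.commute)
  qed
  \<comment> \<open>A Bessel bound \<open>B\<close> need not be at least \<open>A\<close>, whereas
    the frame definition demands ordered constants.\<close>
  have upper: "s f \<le> max A B * (norm f)\<^sup>2" for f
    by (rule order_trans[OF B mult_right_mono]) simp_all
  show ?thesis
    unfolding fusion_frame_for_def hilbert_adjoint_hilbert_adjoint
    using ws summable A upper[unfolded s_def] lower[unfolded s_def]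
    by (intro conjI exI[of _ A] exI[of _ "max A B"] allI) simp_all
qed

end

end

end

theorem theorem3p2:
  fixes smul :: "'k::real_or_complex \<Rightarrow> 'h::banach \<Rightarrow> 'h"
    and ip :: "'h \<Rightarrow> 'h \<Rightarrow> 'k"
    and K :: "'h \<Rightarrow> 'h"
    and I :: "'i set"
    and W V :: "'i \<Rightarrow> 'h set"
    and \<omega> \<upsilon> :: "'i \<Rightarrow> real"
    and m :: "'i \<Rightarrow> 'k"
  assumes "hilbert_space smul ip"
    and "separable_space (euclidean :: 'h topology)"
    and "bounded_operator smul K"
    and "closed (range K)"
    and "countable I"
    and "fusion_frame_for smul ip K I W \<omega>"
    and "bessel_fusion_sequence smul ip I V \<upsilon>"
    and "bounded (m ` I)"
  shows "(fusion_multiplier smul ip K I m W \<omega> V \<upsilon> = K \<longrightarrow>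
      (\<exists>A>0. \<forall>f. A * (norm (K f))\<^sup>2 \<le> (\<Sum>\<^sub>\<infinity>i\<in>I. (\<upsilon> i)\<^sup>2 * (norm (orth_proj ip (V i) f))\<^sup>2)) \<and>
      fusion_frame_for smul ip (hilbert_adjoint ip K) I V \<upsilon>) \<and>
    (has_K_left_inverse smul K (fusion_multiplier smul ip K I m W \<omega> V \<upsilon>) \<longrightarrow>
      fusion_frame_for smul ip (hilbert_adjoint ip K) I V \<upsilon>)"
proof -
  interpret hilbert_space smul ip by fact
  note frame = K_dual_fusion_frame[OF assms(3,4,6,7,8)]
  \<comment> \<open>The explicit lower bound in the first assertion is read off the frame property,
    since the double adjoint of \<open>K\<close> is \<open>K\<close>.\<close>
  have "\<exists>A>0. \<forall>f. A * (norm (K f))\<^sup>2 \<le> (\<Sum>\<^sub>\<infinity>i\<in>I. (\<upsilon> i)\<^sup>2 * (norm (orth_proj ip (V i) f))\<^sup>2)"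
    if "fusion_frame_for smul ip (hilbert_adjoint ip K) I V \<upsilon>"
    using that unfolding fusion_frame_for_def hilbert_adjoint_hilbert_adjoint[OF assms(3)] by blast
  then show ?thesis using frame has_K_left_inverse_self[of K] by auto
qed

end
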